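(* Let $p(x)=x^n+a_{n-1}x^{n-1}+\cdots+a_1x+a_0$ be a monic complex polynomial of degree $n\ge 1$. Let $r=\max\left\{k\in\{1,\ldots,n-1\} \;:\; \sum_{i=0}^{k-1}|a_i|<1\right\}$, with $r=0$ if this set is empty (in particular, if $|a_0|\ge 1$). Then $\|L_r\|_\infty\le\|L_b\|_\infty$ for all $b\in\{0,1,2,\ldots,n-2\}$.
   Context: For an $n\times n$ complex matrix $A=[a_{ij}]$, $\|A\|_\infty=\max_i\sum_j|a_{ij}|$. For $0\le b\le n-1$, $L_b$ is the $n\times n$ matrix with $1$ in each position $(i,i+1)$, $1\le i\le n-1$, with $-a_k$ in position $(n,k+1)$ for $0\le k\le b$, with $-a_k$ in position $(n-k+b,\,b+1)$ for $b+1\le k\le n-1$, and all other entries $0$. That is, $-a_0,\ldots,-a_b$ are in the last row and $-a_{b+1},\ldots,-a_{n-1}$ are stacked above $-a_b$ in column $b+1$. (It is a companion matrix of $p$; $L_{n-1}$ is the Frobenius companion matrix.) *)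

theory Defs
  imports "Jordan_Normal_Form.Matrix" "HOL-Computational_Algebra.Polynomial" Complex_Main
begin

text \<open>Maximum absolute row sum; meaningful only if the matrix has at least one row.\<close>

definition inf_norm_mat :: "complex mat \<Rightarrow> real" where
  "inf_norm_mat A = Max ((\<lambda>i. \<Sum>j<dim_col A. cmod (A $$ (i, j))) ` {..<dim_row A})"

text \<open>
  The entry in row \<open>i\<close> and column \<open>j\<close>, both counted from \<open>1\<close>, of the matrix \<open>L_b\<close> for the
  coefficients \<open>a 0, ..., a (n - 1)\<close>. In column \<open>b + 1\<close> the coefficient \<open>a k\<close> stands in row
  \<open>i = n - k + b\<close>, so \<open>k = n + b - i\<close>, and \<open>b + 1 \<le> k \<le> n - 1\<close> is the same as
  \<open>b + 1 \<le> i \<le> n - 1\<close>.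
\<close>

definition L_entry :: "nat \<Rightarrow> (nat \<Rightarrow> complex) \<Rightarrow> nat \<Rightarrow> nat \<Rightarrow> nat \<Rightarrow> complex" where
  "L_entry n a b i j =
     (if i \<le> n - 1 \<and> j = i + 1 then 1
      else if i = n \<and> j \<le> b + 1 then - a (j - 1)
      else if b + 1 \<le> i \<and> i \<le> n - 1 \<and> j = b + 1 then - a (n + b - i)
      else 0)"

text \<open>Indices of type \<open>mat\<close> start at \<open>0\<close>. The intended range is \<open>b \<le> n - 1\<close>.\<close>

definition L_mat :: "nat \<Rightarrow> (nat \<Rightarrow> complex) \<Rightarrow> nat \<Rightarrow> complex mat" where
  "L_mat n a b = mat n n (\<lambda>(i, j). L_entry n a b (i + 1) (j + 1))"

lemma L_entry_superdiagonal:
  "1 \<le> i \<Longrightarrow> i \<le> n - 1 \<Longrightarrow> L_entry n a b i (i + 1) = 1"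
  by (simp add: L_entry_def)

lemma L_entry_last_row:
  "b < n \<Longrightarrow> k \<le> b \<Longrightarrow> L_entry n a b n (k + 1) = - a k"
  by (auto simp: L_entry_def)

lemma L_entry_column:
  "b + 1 \<le> k \<Longrightarrow> k \<le> n - 1 \<Longrightarrow> L_entry n a b (n - k + b) (b + 1) = - a k"
  by (auto simp: L_entry_def)

lemma L_entry_other:
  assumes "1 \<le> i" "i \<le> n" "1 \<le> j" "j \<le> n" "b < n"
    and "\<not> (i \<le> n - 1 \<and> j = i + 1)"
    and "\<not> (\<exists>k\<le>b. i = n \<and> j = k + 1)"
    and "\<not> (\<exists>k\<in>{b + 1..n - 1}. i = n - k + b \<and> j = b + 1)"
  shows "L_entry n a b i j = 0"
proof -
  have "\<not> (i = n \<and> j \<le> b + 1)"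
  proof
    assume "i = n \<and> j \<le> b + 1"
    then have "j - 1 \<le> b \<and> i = n \<and> j = (j - 1) + 1" using assms(3) by auto
    then show False using assms(7) by blast
  qed
  moreover have "\<not> (b + 1 \<le> i \<and> i \<le> n - 1 \<and> j = b + 1)"
  proof
    assume "b + 1 \<le> i \<and> i \<le> n - 1 \<and> j = b + 1"
    then have "n + b - i \<in> {b + 1..n - 1} \<and> i = n - (n + b - i) + b \<and> j = b + 1"
      using assms(5) by auto
    then show False using assms(8) by blast
  qed
  ultimately show ?thesis using assms(6) unfolding L_entry_def by presburger
qed

definition opt_index :: "nat \<Rightarrow> (nat \<Rightarrow> complex) \<Rightarrow> nat" where
  "opt_index n a =
     (let K = {k \<in> {1..n - 1}. (\<Sum>i = 0..k - 1. cmod (a i)) < 1}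
      in if K = {} then 0 else Max K)"

end

(* Writing S b for the sum of |a 0|, ..., |a b|, the row sums of L_b are S b (last row), 1 + |a k| for
   b < k < n, and 1 (rows above the column of coefficients). For r = opt_index:
   if b < r, then S r <= 1 + |a r|, which is a row sum of L_b; if r < b, then 1 <= S r, so
   every row sum 1 + |a k| with r < k <= b is at most S r + |a k| <= S b. *)

theory Submission imports Defs begin

lemma inf_norm_mat_le_iff:
  assumes "dim_row A > 0"
  shows "inf_norm_mat A \<le> c \<longleftrightarrow> (\<forall>i<dim_row A. (\<Sum>j<dim_col A. cmod (A $$ (i, j))) \<le> c)"
  unfolding inf_norm_mat_def using assms by (subst Max_le_iff) auto

lemma L_mat_row_sum_last:
  assumes "b < n"
  shows "(\<Sum>j<n. cmod (L_mat n a b $$ (n - 1, j))) = (\<Sum>j\<le>b. cmod (a j))"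
proof -
  have "(\<Sum>j<n. cmod (L_mat n a b $$ (n - 1, j))) = (\<Sum>j<n. if j \<le> b then cmod (a j) else 0)"
    using assms by (intro sum.cong) (auto simp: L_mat_def L_entry_def)
  also have "\<dots> = (\<Sum>j\<le>b. cmod (a j))"
    using assms by (intro sum.mono_neutral_cong_right) auto
  finally show ?thesis .
qed

text \<open>The \<open>1\<close> of row \<open>i\<close> is in column \<open>Suc i\<close> and a
  coefficient can only be in column \<open>b\<close>. When \<open>b \<le> i\<close> these columns
  differ, so the two absolute values simply add up.\<close>

lemma L_mat_row_sum_not_last:
  assumes "b < n" "i < n - 1"
  shows "(\<Sum>j<n. cmod (L_mat n a b $$ (i, j))) = 1 + (if b \<le> i then cmod (a (n + b - Suc i)) else 0)"
proof -
  have "(\<Sum>j<n. cmod (L_mat n a b $$ (i, j))) =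
      (\<Sum>j<n. (if j = Suc i then 1 else 0)
        + (if j = b then if b \<le> i then cmod (a (n + b - Suc i)) else 0 else 0))"
    using assms by (intro sum.cong) (auto simp: L_mat_def L_entry_def)
  also have "\<dots> = 1 + (if b \<le> i then cmod (a (n + b - Suc i)) else 0)"
    using assms by (simp add: sum.distrib)
  finally show ?thesis .
qed

text \<open>Comparing norms through their upper bounds \<open>c\<close> avoids evaluating the
  maximum. The guard \<open>0 < b\<close> is there because a row of sum exactly 1, above the column
  of coefficients, exists only then.\<close>

lemma inf_norm_L_mat_le_iff:
  assumes "b < n"
  shows "inf_norm_mat (L_mat n a b) \<le> c \<longleftrightarrow>
    (\<Sum>j\<le>b. cmod (a j)) \<le> c \<and> (0 < b \<longrightarrow> 1 \<le> c) \<and> (\<forall>k\<in>{b<..<n}. 1 + cmod (a k) \<le> c)"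
    (is "_ \<longleftrightarrow> ?last \<and> ?top \<and> ?mid")
proof -
  let ?R = "\<lambda>i. \<Sum>j<n. cmod (L_mat n a b $$ (i, j))"
  have "inf_norm_mat (L_mat n a b) \<le> c \<longleftrightarrow> (\<forall>i<n. ?R i \<le> c)"
    using assms by (subst inf_norm_mat_le_iff) (auto simp: L_mat_def)
  also have "\<dots> \<longleftrightarrow> ?last \<and> ?top \<and> ?mid"
  proof
    assume R: "\<forall>i<n. ?R i \<le> c"
    have ?last
      using R[rule_format, of "n - 1"] assms unfolding L_mat_row_sum_last[OF assms] by linarith
    moreover have ?top
      using R[rule_format, of 0] assms by (auto simp: L_mat_row_sum_not_last)
    moreover have "1 + cmod (a k) \<le> c" if "k \<in> {b<..<n}" for k
    proof -
      \<comment> \<open>Solves \<open>n + b - Suc i = k\<close>: this is the row, counted from 0,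
        with \<open>- a k\<close> in column \<open>b\<close>.\<close>
      define i where "i = n + b - Suc k"
      have i: "i < n - 1" "b \<le> i" "n + b - Suc i = k" "i < n"
        using that assms by (auto simp: i_def)
      then show ?thesis
        using R[rule_format, of i] assms by (simp add: L_mat_row_sum_not_last)
    qed
    ultimately show "?last \<and> ?top \<and> ?mid" by blast
  next
    assume B: "?last \<and> ?top \<and> ?mid"
    show "\<forall>i<n. ?R i \<le> c"
    proof (intro allI impI)
      fix i assume "i < n"
      then consider "i = n - 1" | "i < n - 1" "i < b" | "i < n - 1" "b \<le> i" by linarith
      then show "?R i \<le> c"
      proof cases
        case 1
        with B show ?thesis unfolding 1 L_mat_row_sum_last[OF assms] by blast
      next
        case 2
        with B assms show ?thesis by (simp add: L_mat_row_sum_not_last)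
      next
        case 3
        then have "n + b - Suc i \<in> {b<..<n}" using assms by auto
        with B 3 assms show ?thesis by (simp add: L_mat_row_sum_not_last)
      qed
    qed
  qed
  finally show ?thesis .
qed

text \<open>For \<open>r \<noteq> 0\<close>, membership of \<open>r\<close> in the set of admissible
  indices bounds the sum over \<open>j < r\<close> by 1, and adding \<open>cmod (a r)\<close> gives
  the second claim; for \<open>r = 0\<close> that claim is trivial. The third claim is the
  maximality of \<open>r\<close>.\<close>

lemma opt_index_props:
  fixes a :: "nat \<Rightarrow> complex" and n :: nat
  defines "r \<equiv> opt_index n a"
  shows "r \<le> n - 1"
    and "(\<Sum>j\<le>r. cmod (a j)) \<le> 1 + cmod (a r)"
    and "r < n - 1 \<Longrightarrow> 1 \<le> (\<Sum>j\<le>r. cmod (a j))"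
proof -
  define K where "K = {k \<in> {1..n - 1}. (\<Sum>i = 0..k - 1. cmod (a i)) < 1}"
  have fin: "finite K" by (simp add: K_def)
  have r: "r = (if K = {} then 0 else Max K)"
    unfolding r_def opt_index_def K_def Let_def ..
  have in_K: "r \<in> K" if "r \<noteq> 0"
    using that r Max_in[OF fin] by (cases "K = {}") simp_all
  show "r \<le> n - 1"
    using in_K by (cases "r = 0") (auto simp: K_def)
  show "(\<Sum>j\<le>r. cmod (a j)) \<le> 1 + cmod (a r)"
  proof (cases r)
    case (Suc m)
    then show ?thesis using in_K by (simp add: K_def atLeast0AtMost)
  qed simp
  show "1 \<le> (\<Sum>j\<le>r. cmod (a j))" if "r < n - 1"
  proof -
    \<comment> \<open>Since \<open>r < n - 1\<close>, the index \<open>Suc r\<close> is in the range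
      \<open>{1..n - 1}\<close>, so it can fail to be in \<open>K\<close> only because the sum up to
      \<open>Suc r - 1 = r\<close> is at least 1.\<close>
    have "Suc r \<notin> K"
      using r Max_ge[OF fin, of "Suc r"] by (cases "K = {}") auto
    then show ?thesis using that by (simp add: K_def atLeast0AtMost)
  qed
qed

theorem theorem4p2:
  fixes p :: "complex poly" and n :: nat
  assumes "n \<ge> 1" and "degree p = n" and "lead_coeff p = 1"
  shows "\<forall>b \<in> {..<n - 1}.
    inf_norm_mat (L_mat n (coeff p) (opt_index n (coeff p))) \<le> inf_norm_mat (L_mat n (coeff p) b)"
proof
  fix b assume "b \<in> {..<n - 1}"
  then have b: "b < n - 1" "b < n" by auto
  define a where "a = coeff p"
  define r where "r = opt_index n a"
  define c where "c = inf_norm_mat (L_mat n a b)"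
  let ?S = "\<lambda>m. \<Sum>j\<le>m. cmod (a j)"
  note opt = opt_index_props[where a = a and n = n, folded r_def]
  have r: "r < n" using opt(1) b by linarith
  have mid: "1 + cmod (a k) \<le> c" if "b < k" "k < n" for k
    using inf_norm_L_mat_le_iff[OF b(2), of a c] that b by (auto simp: c_def)
  have last: "?S b \<le> c"
    using inf_norm_L_mat_le_iff[OF b(2), of a c] by (auto simp: c_def)
  \<comment> \<open>As \<open>b < n - 1\<close>, the index \<open>n - 1\<close> is a legitimate
    \<open>k\<close> in \<open>mid\<close>, even when \<open>b = 0\<close>.\<close>
  have one: "1 \<le> c"
    using mid[of "n - 1"] b norm_ge_zero[of "a (n - 1)"] by linarith
  have S_r: "?S r \<le> c"
  proof (cases "b < r")
    case True
    then show ?thesis using opt(2) mid[of r] r by linarith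
  next
    case False
    then have "?S r \<le> ?S b" by (intro sum_mono2) auto
    then show ?thesis using last by linarith
  qed
  have "1 + cmod (a k) \<le> c" if k: "r < k" "k < n" for k
  proof (cases "b < k")
    case True
    then show ?thesis using mid k by blast
  next
    case False
    \<comment> \<open>Here \<open>r < k \<le> b < n - 1\<close>, so \<open>r < n - 1\<close> and the
      1 can be replaced by \<open>?S r\<close>; since \<open>k\<close> is outside
      \<open>{..r}\<close>, the new term extends that sum inside \<open>{..b}\<close>.\<close>
    have "1 + cmod (a k) \<le> ?S r + cmod (a k)" using opt(3) False k b by simp
    also have "\<dots> = sum (\<lambda>j. cmod (a j)) (insert k {..r})" using k by simp
    also have "\<dots> \<le> ?S b" using False k by (intro sum_mono2) auto
    finally show ?thesis using last by linarith
  qed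
  then have "inf_norm_mat (L_mat n a r) \<le> c"
    using S_r one by (subst inf_norm_L_mat_le_iff[OF r]) auto
  then show "inf_norm_mat (L_mat n (coeff p) (opt_index n (coeff p))) \<le> inf_norm_mat (L_mat n (coeff p) b)"
    by (simp add: a_def r_def c_def)
qed

end
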